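(* Let $\mathsf{C}$ be a category. Any relatively initial morphism of diagrams $(R,\rho)$ in $\mathrm{Diag}_{\rightarrow}(\mathsf{C})$ has the pushforward property. Consequently, if $(R,\rho): D \to D'$ is a strong morphism in $\mathrm{Diag}_{\leftarrow}(\mathsf{C})$ (i.e. $\rho$ is a natural isomorphism) such that the morphism $(R,\rho^{-1}): D' \to D$ in $\mathrm{Diag}_{\rightarrow}(\mathsf{C})$ is relatively initial, then $(R,\rho)$ is a weak equivalence of diagrams.
   Context: A diagram in a category $\mathsf{C}$ is a functor $D: \mathsf{J} \to \mathsf{C}$ with $\mathsf{J}$ a small category. The category $\mathrm{Diag}_{\rightarrow}(\mathsf{C})$ has as objects the diagrams $(\mathsf{J}, D)$ in $\mathsf{C}$ and as morphisms $(\mathsf{J}, D) \to (\mathsf{J}', D')$ the pairs $(R,\rho)$ of a functor $R: \mathsf{J} \to \mathsf{J}'$ and a natural transformation $\rho: D \Rightarrow D' \circ R$. The category $\mathrm{Diag}_{\leftarrow}(\mathsf{C})$ has the same objects, and its morphisms $(\mathsf{J}, D) \to (\mathsf{J}', D')$ are the pairs $(R,\rho)$ of a functor $R: \mathsf{J}' \to \mathsf{J}$ and a natural transformation $\rho: D \circ R \Rightarrow D'$. Composition is by pasting, and identities are $(\mathrm{id}_{\mathsf{J}}, \mathrm{id}_D)$. A morphism $(R,\rho)$ in either category is strong if $\rho$ is a natural isomorphism. A functor $F: \mathsf{C} \to \mathsf{D}$ induces a functor $\mathrm{Diag}_{\rightarrow}(F): \mathrm{Diag}_{\rightarrow}(\mathsf{C})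 \to \mathrm{Diag}_{\rightarrow}(\mathsf{D})$ by $(\mathsf{J},D) \mapsto (\mathsf{J}, F \circ D)$ and $(R,\rho) \mapsto (R, F*\rho)$ (whiskering). Discrete opfibration at a morphism: a functor $\pi: \mathsf{E} \to \mathsf{C}$ is a discrete opfibration at a morphism $f: x \to y$ of $\mathsf{C}$ if, for every object $\overline{x} \in \mathsf{E}$ with $\pi(\overline{x}) = x$, there exists a unique morphism $\overline{f}$ in $\mathsf{E}$ with domain $\overline{x}$ (and codomain not prescribed) such that $\pi(\overline{f}) = f$. It is a discrete opfibration if it is so at every morphism of $\mathsf{C}$. Pushforward property: a morphism $(R,\rho)$ in $\mathrm{Diag}_{\rightarrow}(\mathsf{C})$ has the pushforward property if, for any discrete opfibration $\pi: \mathsf{E} \to \mathsf{C}$, the functor $\mathrm{Diag}_{\rightarrow}(\pi): \mathrm{Diag}_{\rightarrow}(\mathsf{E}) \to \mathrm{Diag}_{\rightarrow}(\mathsf{C})$ is a discrete opfibration at $(R,\rho)$. Weak equivalence: a weak equivalence between diagrams $D$ and $D'$ in $\mathsf{C}$ is a strong morphism $(R,\rho): D \to D'$ in $\mathrm{Diag}_{\leftarrow}(\mathsf{C})$ such that the morphism $(R,\rho^{-1}): D' \to D$ in $\mathrm{Diag}_{\rightarrow}(\mathsf{C})$ has the pushforward property. Relatively initial: let $(R,\rho): (\mathsf{J}, D) \to (\mathsf{J}', D')$ be a morphism in $\mathrm{Diag}_{\rightarrow}(\mathsf{C})$. For $j' \in \mathsf{J}'$, the category $(R,\rho)/j'$ has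 as objects the pairs $(j,f')$ with $j \in \mathsf{J}$ and $f': Rj \to j'$ in $\mathsf{J}'$, and as morphisms $(j,f') \to (k,g')$ the morphisms $h: j \to k$ in $\mathsf{J}$ such that $D'f' \circ \rho_j = D'g' \circ \rho_k \circ Dh$ as morphisms $Dj \to D'j'$; composition and identities are as in $\mathsf{J}$. The morphism $(R,\rho)$ is relatively initial if, for every $j' \in \mathsf{J}'$, the category $(R,\rho)/j'$ is nonempty and connected (any two objects are joined by a finite zig-zag of morphisms). *)

theory Defs
  imports Main "HOL-Library.FuncSet"
begin

section \<open>Categories and functors\<close>

record ('o, 'm) cat =
  Obj :: "'o set"
  Arr :: "'m set"
  Dom :: "'m \<Rightarrow> 'o"
  Cod :: "'m \<Rightarrow> 'o"
  Ide :: "'o \<Rightarrow> 'm"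
  Comp :: "'m \<Rightarrow> 'm \<Rightarrow> 'm"

definition hom :: "('o, 'm) cat \<Rightarrow> 'o \<Rightarrow> 'o \<Rightarrow> 'm set" where
  "hom C x y = {f \<in> Arr C. Dom C f = x \<and> Cod C f = y}"

text \<open>
  All structure maps take the value \<open>undefined\<close> off their proper domain, here and for functors and
  natural transformations below. Hence HOL equality of categories, functors, transformations (and
  so of diagrams and of their morphisms) is the intended equality.
\<close>

locale category =
  fixes C :: "('o, 'm) cat"
  assumes Dom_ext: "Dom C \<in> Arr C \<rightarrow>\<^sub>E Obj C"
    and Cod_ext: "Cod C \<in> Arr C \<rightarrow>\<^sub>E Obj C"
    and Id_ext: "Ide C \<in> extensional (Obj C)"
    and Id_hom: "x \<in> Obj C \<Longrightarrow> Ide C x \<in> hom C x x"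
    and Comp_hom: "f \<in> hom C x y \<Longrightarrow> g \<in> hom C y z \<Longrightarrow> Comp C g f \<in> hom C x z"
    and Comp_undef:
      "\<not> (f \<in> Arr C \<and> g \<in> Arr C \<and> Dom C g = Cod C f) \<Longrightarrow> Comp C g f = undefined"
    and Comp_Id_right: "f \<in> hom C x y \<Longrightarrow> Comp C f (Ide C x) = f"
    and Comp_Id_left: "f \<in> hom C x y \<Longrightarrow> Comp C (Ide C y) f = f"
    and Comp_assoc: "f \<in> hom C w x \<Longrightarrow> g \<in> hom C x y \<Longrightarrow> h \<in> hom C y z \<Longrightarrow>
      Comp C h (Comp C g f) = Comp C (Comp C h g) f"

record ('a, 'b, 'o, 'm) funct =
  FO :: "'a \<Rightarrow> 'o"
  FA :: "'b \<Rightarrow> 'm"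

definition is_functor :: "('a, 'b) cat \<Rightarrow> ('o, 'm) cat \<Rightarrow> ('a, 'b, 'o, 'm) funct \<Rightarrow> bool" where
  "is_functor A B F \<longleftrightarrow> category A \<and> category B \<and>
     FO F \<in> Obj A \<rightarrow>\<^sub>E Obj B \<and> FA F \<in> Arr A \<rightarrow>\<^sub>E Arr B \<and>
     (\<forall>f\<in>Arr A. Dom B (FA F f) = FO F (Dom A f) \<and> Cod B (FA F f) = FO F (Cod A f)) \<and>
     (\<forall>x\<in>Obj A. FA F (Ide A x) = Ide B (FO F x)) \<and>
     (\<forall>f\<in>Arr A. \<forall>g\<in>Arr A. Dom A g = Cod A f \<longrightarrow>
        FA F (Comp A g f) = Comp B (FA F g) (FA F f))"

definition id_funct :: "('a, 'b) cat \<Rightarrow> ('a, 'b, 'a, 'b) funct" where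
  "id_funct A = \<lparr>FO = (\<lambda>x\<in>Obj A. x), FA = (\<lambda>f\<in>Arr A. f)\<rparr>"

text \<open>\<open>comp_funct A G F\<close> is the composite \<open>G \<circ> F\<close>, where \<open>A\<close> is the domain of \<open>F\<close>.\<close>

definition comp_funct ::
  "('a, 'b) cat \<Rightarrow> ('c, 'd, 'o, 'm) funct \<Rightarrow> ('a, 'b, 'c, 'd) funct \<Rightarrow> ('a, 'b, 'o, 'm) funct" where
  "comp_funct A G F = \<lparr>FO = compose (Obj A) (FO G) (FO F), FA = compose (Arr A) (FA G) (FA F)\<rparr>"

definition nat_trans :: "('a, 'b) cat \<Rightarrow> ('o, 'm) cat \<Rightarrow> ('a, 'b, 'o, 'm) funct \<Rightarrow>
    ('a, 'b, 'o, 'm) funct \<Rightarrow> ('a \<Rightarrow> 'm) \<Rightarrow> bool" where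
  "nat_trans A B F G \<tau> \<longleftrightarrow> is_functor A B F \<and> is_functor A B G \<and>
     \<tau> \<in> extensional (Obj A) \<and>
     (\<forall>x\<in>Obj A. \<tau> x \<in> hom B (FO F x) (FO G x)) \<and>
     (\<forall>f\<in>Arr A. Comp B (FA G f) (\<tau> (Dom A f)) = Comp B (\<tau> (Cod A f)) (FA F f))"

definition inverse_arrows :: "('o, 'm) cat \<Rightarrow> 'm \<Rightarrow> 'm \<Rightarrow> bool" where
  "inverse_arrows C f g \<longleftrightarrow> f \<in> Arr C \<and> g \<in> Arr C \<and>
     Dom C g = Cod C f \<and> Cod C g = Dom C f \<and>
     Comp C g f = Ide C (Dom C f) \<and> Comp C f g = Ide C (Cod C f)"

definition iso :: "('o, 'm) cat \<Rightarrow> 'm \<Rightarrow> bool" where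
  "iso C f \<longleftrightarrow> (\<exists>g. inverse_arrows C f g)"

definition inv_arr :: "('o, 'm) cat \<Rightarrow> 'm \<Rightarrow> 'm" where
  "inv_arr C f = (THE g. inverse_arrows C f g)"

definition nat_iso :: "('a, 'b) cat \<Rightarrow> ('o, 'm) cat \<Rightarrow> ('a, 'b, 'o, 'm) funct \<Rightarrow>
    ('a, 'b, 'o, 'm) funct \<Rightarrow> ('a \<Rightarrow> 'm) \<Rightarrow> bool" where
  "nat_iso A B F G \<tau> \<longleftrightarrow> nat_trans A B F G \<tau> \<and> (\<forall>x\<in>Obj A. iso B (\<tau> x))"

definition inv_trans :: "('a, 'b) cat \<Rightarrow> ('o, 'm) cat \<Rightarrow> ('a \<Rightarrow> 'm) \<Rightarrow> ('a \<Rightarrow> 'm)" where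
  "inv_trans A B \<tau> = (\<lambda>x\<in>Obj A. inv_arr B (\<tau> x))"

definition discrete_opfibration_at ::
  "('a, 'b) cat \<Rightarrow> ('o, 'm) cat \<Rightarrow> ('a, 'b, 'o, 'm) funct \<Rightarrow> 'm \<Rightarrow> bool" where
  "discrete_opfibration_at E C \<pi> f \<longleftrightarrow> is_functor E C \<pi> \<and> f \<in> Arr C \<and>
     (\<forall>x\<in>Obj E. FO \<pi> x = Dom C f \<longrightarrow> (\<exists>!g. g \<in> Arr E \<and> Dom E g = x \<and> FA \<pi> g = f))"

definition discrete_opfibration ::
  "('a, 'b) cat \<Rightarrow> ('o, 'm) cat \<Rightarrow> ('a, 'b, 'o, 'm) funct \<Rightarrow> bool" where
  "discrete_opfibration E C \<pi> \<longleftrightarrow> is_functor E C \<pi> \<and>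
     (\<forall>f\<in>Arr C. discrete_opfibration_at E C \<pi> f)"

definition connected_cat :: "('o, 'm) cat \<Rightarrow> bool" where
  "connected_cat C \<longleftrightarrow> (let S = {(Dom C f, Cod C f) | f. f \<in> Arr C} in
     \<forall>x\<in>Obj C. \<forall>y\<in>Obj C. (x, y) \<in> (S \<union> S\<inverse>)\<^sup>*)"


section \<open>Categories of diagrams\<close>

text \<open>
  Small categories are the categories whose objects and arrows form sets over two types
  \<open>'jo\<close> and \<open>'jm\<close>; these types are arbitrary, so they play the role of the universe of small sets.
  A diagram in \<open>C\<close> is a pair \<open>(J, D)\<close> with \<open>D : J \<rightarrow> C\<close>. A single record holds the data of
  morphisms in both diagram categories; \<open>Shape\<close> and \<open>Trans\<close> are \<open>R\<close> and \<open>\<rho>\<close>.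
\<close>

type_synonym ('jo, 'jm, 'o, 'm) diagram = "('jo, 'jm) cat \<times> ('jo, 'jm, 'o, 'm) funct"

record ('jo, 'jm, 'o, 'm) diag_arr =
  Src :: "('jo, 'jm, 'o, 'm) diagram"
  Tgt :: "('jo, 'jm, 'o, 'm) diagram"
  Shape :: "('jo, 'jm, 'jo, 'jm) funct"
  Trans :: "'jo \<Rightarrow> 'm"

definition diagrams :: "('o, 'm) cat \<Rightarrow> ('jo, 'jm, 'o, 'm) diagram set" where
  "diagrams C = {(J, D). is_functor J C D}"

definition diag_right_arrs :: "('o, 'm) cat \<Rightarrow> ('jo, 'jm, 'o, 'm) diag_arr set" where
  "diag_right_arrs C = {\<lparr>Src = (J, D), Tgt = (J', D'), Shape = R, Trans = \<rho>\<rparr> | J D J' D' R \<rho>.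
     is_functor J C D \<and> is_functor J' C D' \<and>
     is_functor J J' R \<and> nat_trans J C D (comp_funct J D' R) \<rho>}"

definition diag_left_arrs :: "('o, 'm) cat \<Rightarrow> ('jo, 'jm, 'o, 'm) diag_arr set" where
  "diag_left_arrs C = {\<lparr>Src = (J, D), Tgt = (J', D'), Shape = R, Trans = \<rho>\<rparr> | J D J' D' R \<rho>.
     is_functor J C D \<and> is_functor J' C D' \<and>
     is_functor J' J R \<and> nat_trans J' C (comp_funct J' D R) D' \<rho>}"

definition diag_id :: "('o, 'm) cat \<Rightarrow> ('jo, 'jm, 'o, 'm) diagram \<Rightarrow> ('jo, 'jm, 'o, 'm) diag_arr" where
  "diag_id C = (\<lambda>(J, D). \<lparr>Src = (J, D), Tgt = (J, D), Shape = id_funct J,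
     Trans = (\<lambda>j\<in>Obj J. Ide C (FO D j))\<rparr>)"

definition Diag_right :: "('o, 'm) cat \<Rightarrow>
    (('jo, 'jm, 'o, 'm) diagram, ('jo, 'jm, 'o, 'm) diag_arr) cat" where
  "Diag_right C = \<lparr>
     Obj = diagrams C,
     Arr = diag_right_arrs C,
     Dom = (\<lambda>m\<in>diag_right_arrs C. Src m),
     Cod = (\<lambda>m\<in>diag_right_arrs C. Tgt m),
     Ide = (\<lambda>X\<in>diagrams C. diag_id C X),
     Comp = (\<lambda>n m.
       if m \<in> diag_right_arrs C \<and> n \<in> diag_right_arrs C \<and> Src n = Tgt m then
         (let J = fst (Src m) in
           \<lparr>Src = Src m, Tgt = Tgt n, Shape = comp_funct J (Shape n) (Shape m),
            Trans = (\<lambda>j\<in>Obj J. Comp C (Trans n (FO (Shape m) j)) (Trans m j))\<rparr>)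
       else undefined)\<rparr>"

definition Diag_left :: "('o, 'm) cat \<Rightarrow>
    (('jo, 'jm, 'o, 'm) diagram, ('jo, 'jm, 'o, 'm) diag_arr) cat" where
  "Diag_left C = \<lparr>
     Obj = diagrams C,
     Arr = diag_left_arrs C,
     Dom = (\<lambda>m\<in>diag_left_arrs C. Src m),
     Cod = (\<lambda>m\<in>diag_left_arrs C. Tgt m),
     Ide = (\<lambda>X\<in>diagrams C. diag_id C X),
     Comp = (\<lambda>n m.
       if m \<in> diag_left_arrs C \<and> n \<in> diag_left_arrs C \<and> Src n = Tgt m then
         (let K = fst (Tgt n) in
           \<lparr>Src = Src m, Tgt = Tgt n, Shape = comp_funct K (Shape m) (Shape n),
            Trans = (\<lambda>k\<in>Obj K. Comp C (Trans n k) (Trans m (FO (Shape n) k)))\<rparr>)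
       else undefined)\<rparr>"

text \<open>The functor \<open>Diag_right E \<rightarrow> Diag_right C\<close> induced by \<open>F : E \<rightarrow> C\<close>.\<close>

definition Diag_right_map :: "('e, 'f) cat \<Rightarrow> ('e, 'f, 'o, 'm) funct \<Rightarrow>
    (('jo, 'jm, 'e, 'f) diagram, ('jo, 'jm, 'e, 'f) diag_arr,
     ('jo, 'jm, 'o, 'm) diagram, ('jo, 'jm, 'o, 'm) diag_arr) funct" where
  "Diag_right_map E F = (let post = (\<lambda>(J, D). (J, comp_funct J F D)) in \<lparr>
     FO = (\<lambda>X\<in>diagrams E. post X),
     FA = (\<lambda>m\<in>diag_right_arrs E.
       \<lparr>Src = post (Src m), Tgt = post (Tgt m), Shape = Shape m,
        Trans = (\<lambda>j\<in>Obj (fst (Src m)). FA F (Trans m j))\<rparr>)\<rparr>)"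

definition strong_left :: "('o, 'm) cat \<Rightarrow> ('jo, 'jm, 'o, 'm) diag_arr \<Rightarrow> bool" where
  "strong_left C m \<longleftrightarrow> m \<in> Arr (Diag_left C) \<and>
     (case (Src m, Tgt m) of ((J, D), (J', D')) \<Rightarrow>
        nat_iso J' C (comp_funct J' D (Shape m)) D' (Trans m))"

text \<open>For a strong \<open>(R, \<rho>) : D \<rightarrow> D'\<close> in \<open>Diag_left C\<close>, this is
  \<open>(R, \<rho>\<inverse>) : D' \<rightarrow> D\<close> in \<open>Diag_right C\<close>.\<close>

definition reverse_arr ::
  "('o, 'm) cat \<Rightarrow> ('jo, 'jm, 'o, 'm) diag_arr \<Rightarrow> ('jo, 'jm, 'o, 'm) diag_arr" where
  "reverse_arr C m = \<lparr>Src = Tgt m, Tgt = Src m, Shape = Shape m,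
     Trans = inv_trans (fst (Tgt m)) C (Trans m)\<rparr>"


section \<open>Pushforward property, weak equivalences, relative initiality\<close>

text \<open>
  HOL cannot quantify over types inside a formula, so the types \<open>'e\<close>, \<open>'f\<close> of objects and arrows
  of the total categories \<open>E\<close> are explicit parameters. A statement asserting the property
  for arbitrary \<open>'e\<close>, \<open>'f\<close> covers all discrete opfibrations.
\<close>

definition pushforward_property :: "'e itself \<Rightarrow> 'f itself \<Rightarrow> ('o, 'm) cat \<Rightarrow>
    ('jo, 'jm, 'o, 'm) diag_arr \<Rightarrow> bool" where
  "pushforward_property _ _ C m \<longleftrightarrow> m \<in> Arr (Diag_right C) \<and>
     (\<forall>(E :: ('e, 'f) cat) \<pi>. discrete_opfibration E C \<pi> \<longrightarrow>
        discrete_opfibration_at (Diag_right E) (Diag_right C) (Diag_right_map E \<pi>) m)"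

definition weak_equivalence :: "'e itself \<Rightarrow> 'f itself \<Rightarrow> ('o, 'm) cat \<Rightarrow>
    ('jo, 'jm, 'o, 'm) diag_arr \<Rightarrow> bool" where
  "weak_equivalence te tf C m \<longleftrightarrow> strong_left C m \<and> pushforward_property te tf C (reverse_arr C m)"

definition rel_slice_objs ::
  "('jo, 'jm, 'o, 'm) diag_arr \<Rightarrow> 'jo \<Rightarrow> ('jo \<times> 'jm) set" where
  "rel_slice_objs m j' = {(j, f'). j \<in> Obj (fst (Src m)) \<and>
     f' \<in> hom (fst (Tgt m)) (FO (Shape m) j) j'}"

text \<open>
  The same arrow \<open>h\<close> of \<open>J\<close> may underlie several arrows of \<open>(R, \<rho>)/j'\<close>, so an arrow is
  represented as a triple (domain, \<open>h\<close>, codomain).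
\<close>

definition rel_slice_arrs :: "('o, 'm) cat \<Rightarrow>
    ('jo, 'jm, 'o, 'm) diag_arr \<Rightarrow> 'jo \<Rightarrow> (('jo \<times> 'jm) \<times> 'jm \<times> ('jo \<times> 'jm)) set" where
  "rel_slice_arrs C m j' = (case (Src m, Tgt m) of ((J, D), (J', D')) \<Rightarrow>
     {((j, f'), h, (k, g')) | j f' h k g'.
        (j, f') \<in> rel_slice_objs m j' \<and> (k, g') \<in> rel_slice_objs m j' \<and> h \<in> hom J j k \<and>
        Comp C (FA D' f') (Trans m j) = Comp C (FA D' g') (Comp C (Trans m k) (FA D h))})"

definition rel_slice :: "('o, 'm) cat \<Rightarrow> ('jo, 'jm, 'o, 'm) diag_arr \<Rightarrow> 'jo \<Rightarrow>
    ('jo \<times> 'jm, ('jo \<times> 'jm) \<times> 'jm \<times> ('jo \<times> 'jm)) cat" where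
  "rel_slice C m j' = (let J = fst (Src m); A = rel_slice_arrs C m j' in \<lparr>
     Obj = rel_slice_objs m j',
     Arr = A,
     Dom = (\<lambda>a\<in>A. fst a),
     Cod = (\<lambda>a\<in>A. snd (snd a)),
     Ide = (\<lambda>x\<in>rel_slice_objs m j'. (x, Ide J (fst x), x)),
     Comp = (\<lambda>b a. if a \<in> A \<and> b \<in> A \<and> fst b = snd (snd a)
       then (fst a, Comp J (fst (snd b)) (fst (snd a)), snd (snd b)) else undefined)\<rparr>)"

definition relatively_initial :: "('o, 'm) cat \<Rightarrow> ('jo, 'jm, 'o, 'm) diag_arr \<Rightarrow> bool" where
  "relatively_initial C m \<longleftrightarrow> m \<in> Arr (Diag_right C) \<and>
     (\<forall>j'\<in>Obj (fst (Tgt m)). Obj (rel_slice C m j') \<noteq> {} \<and> connected_cat (rel_slice C m j'))"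

end

theory Submission
  imports Defs
begin

text \<open>
  A discrete opfibration \<open>\<pi> : E \<rightarrow> C\<close> transports objects of \<open>E\<close> functorially along arrows of \<open>C\<close>.
  Given \<open>(R, \<rho>) : (J, D) \<rightarrow> (J', D')\<close> and a lift \<open>X\<close> of \<open>D\<close>, any lift of \<open>(R, \<rho>)\<close> starting at \<open>X\<close>
  must send \<open>j'\<close> to the transport of \<open>X j\<close> along \<open>D' f' \<circ> \<rho>\<^sub>j\<close>, for every \<open>(j, f')\<close> in
  \<open>(R, \<rho>)/j'\<close>, and everything else is forced by unique lifting. An arrow \<open>h\<close> of \<open>(R, \<rho>)/j'\<close> does
  not change this transport, because \<open>X h\<close> is the lift of \<open>D h\<close>. So connectedness makes the
  prescription well defined, and nonemptiness makes it total.
\<close>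

section \<open>Functors and natural transformations\<close>

lemma (in category) arr_dom_cod:
  assumes "f \<in> Arr C"
  shows "Dom C f \<in> Obj C" "Cod C f \<in> Obj C" "f \<in> hom C (Dom C f) (Cod C f)"
  using assms Dom_ext Cod_ext by (auto simp: hom_def)

lemma (in category) hom_objs:
  assumes "f \<in> hom C x y"
  shows "x \<in> Obj C" "y \<in> Obj C"
  using assms arr_dom_cod by (auto simp: hom_def)

lemma homD:
  assumes "f \<in> hom C x y"
  shows "f \<in> Arr C" "Dom C f = x" "Cod C f = y"
  using assms by (auto simp: hom_def)

lemma functor_cat:
  assumes "is_functor A B F"
  shows "category A" "category B"
  using assms by (auto simp: is_functor_def)

lemma functor_obj: "is_functor A B F \<Longrightarrow> x \<in> Obj A \<Longrightarrow> FO F x \<in> Obj B"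
  by (auto simp: is_functor_def)

lemma functor_arr: "is_functor A B F \<Longrightarrow> f \<in> Arr A \<Longrightarrow> FA F f \<in> Arr B"
  by (auto simp: is_functor_def)

lemma functor_hom: "is_functor A B F \<Longrightarrow> f \<in> hom A x y \<Longrightarrow> FA F f \<in> hom B (FO F x) (FO F y)"
  by (auto simp: is_functor_def hom_def)

lemma functor_id: "is_functor A B F \<Longrightarrow> x \<in> Obj A \<Longrightarrow> FA F (Ide A x) = Ide B (FO F x)"
  by (auto simp: is_functor_def)

lemma functor_comp:
  "is_functor A B F \<Longrightarrow> f \<in> hom A x y \<Longrightarrow> g \<in> hom A y z \<Longrightarrow>
    FA F (Comp A g f) = Comp B (FA F g) (FA F f)"
  by (auto simp: is_functor_def hom_def)

lemma is_functorI:
  assumes "category A" "category B"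
    and "FO F \<in> extensional (Obj A)" "FA F \<in> extensional (Arr A)"
    and "\<And>x. x \<in> Obj A \<Longrightarrow> FO F x \<in> Obj B"
    and hom: "\<And>f x y. f \<in> hom A x y \<Longrightarrow> FA F f \<in> hom B (FO F x) (FO F y)"
    and "\<And>x. x \<in> Obj A \<Longrightarrow> FA F (Ide A x) = Ide B (FO F x)"
    and "\<And>f g x y z. f \<in> hom A x y \<Longrightarrow> g \<in> hom A y z \<Longrightarrow>
      FA F (Comp A g f) = Comp B (FA F g) (FA F f)"
  shows "is_functor A B F"
proof -
  have "FA F f \<in> hom B (FO F (Dom A f)) (FO F (Cod A f))" if "f \<in> Arr A" for f
    using hom that by (auto simp: hom_def)
  then show ?thesis
    using assms unfolding is_functor_def by (auto simp: PiE_def hom_def)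
qed

text \<open>Both components are extensional, so agreement on objects and arrows already makes the
  records equal.\<close>

lemma functor_eqI:
  assumes F: "is_functor A B F" and G: "is_functor A B G"
    and "\<And>x. x \<in> Obj A \<Longrightarrow> FO F x = FO G x" "\<And>f. f \<in> Arr A \<Longrightarrow> FA F f = FA G f"
  shows "F = G"
proof -
  have "FO F = FO G"
    using F G assms(3) unfolding is_functor_def by (auto intro: PiE_ext)
  moreover have "FA F = FA G"
    using F G assms(4) unfolding is_functor_def by (auto intro: PiE_ext)
  ultimately show ?thesis by simp
qed

lemma FO_comp_funct [simp]: "x \<in> Obj A \<Longrightarrow> FO (comp_funct A G F) x = FO G (FO F x)"
  and FA_comp_funct [simp]: "f \<in> Arr A \<Longrightarrow> FA (comp_funct A G F) f = FA G (FA F f)"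
  by (simp_all add: comp_funct_def compose_def)

lemma FO_id_funct [simp]: "x \<in> Obj A \<Longrightarrow> FO (id_funct A) x = x"
  and FA_id_funct [simp]: "f \<in> Arr A \<Longrightarrow> FA (id_funct A) f = f"
  by (simp_all add: id_funct_def)

lemma is_functor_id_funct:
  assumes "category A"
  shows "is_functor A A (id_funct A)"
proof -
  interpret category A by fact
  show ?thesis
  proof (rule is_functorI[OF assms assms])
    fix x y z f g assume f: "f \<in> hom A x y"
    show "FA (id_funct A) f \<in> hom A (FO (id_funct A) x) (FO (id_funct A) y)"
      using f hom_objs[OF f] homD(1)[OF f] by simp
    assume g: "g \<in> hom A y z"
    show "FA (id_funct A) (Comp A g f) = Comp A (FA (id_funct A) g) (FA (id_funct A) f)"
      using homD(1)[OF f] homD(1)[OF g] homD(1)[OF Comp_hom[OF f g]] by simp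
  next
    show "FA (id_funct A) (Ide A x) = Ide A (FO (id_funct A) x)" if "x \<in> Obj A" for x
      using homD(1)[OF Id_hom[OF that]] that by simp
  qed (simp_all add: id_funct_def)
qed

lemma is_functor_comp_funct:
  assumes F: "is_functor A B F" and G: "is_functor B C G"
  shows "is_functor A C (comp_funct A G F)"
proof -
  interpret A: category A using functor_cat F by blast
  show ?thesis
  proof (rule is_functorI)
    show "category A" "category C" using functor_cat F G by blast+
    show "FO (comp_funct A G F) \<in> extensional (Obj A)"
      and "FA (comp_funct A G F) \<in> extensional (Arr A)"
      by (simp_all add: comp_funct_def)
    show "FO (comp_funct A G F) x \<in> Obj C" if "x \<in> Obj A" for x
      using that F G by (simp add: functor_obj)
    show "FA (comp_funct A G F) f \<in> hom C (FO (comp_funct A G F) x) (FO (comp_funct A G F) y)"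
      if f: "f \<in> hom A x y" for f x y
      using functor_hom[OF G functor_hom[OF F f]] A.hom_objs[OF f] homD[OF f] by simp
    show "FA (comp_funct A G F) (Ide A x) = Ide C (FO (comp_funct A G F) x)"
      if x: "x \<in> Obj A" for x
      using x homD(1)[OF A.Id_hom[OF x]] functor_id[OF F x] functor_id[OF G functor_obj[OF F x]]
      by simp
    show "FA (comp_funct A G F) (Comp A g f) =
        Comp C (FA (comp_funct A G F) g) (FA (comp_funct A G F) f)"
      if f: "f \<in> hom A x y" and g: "g \<in> hom A y z" for f g x y z
      using homD(1)[OF f] homD(1)[OF g] homD(1)[OF A.Comp_hom[OF f g]] functor_comp[OF F f g]
        functor_comp[OF G functor_hom[OF F f] functor_hom[OF F g]]
      by simp
  qed
qed

lemma comp_funct_assoc: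
  assumes F: "is_functor A B F" and G: "is_functor B C G" and H: "is_functor C D H"
  shows "comp_funct A H (comp_funct A G F) = comp_funct A (comp_funct B H G) F"
  using is_functor_comp_funct[OF is_functor_comp_funct[OF F G] H]
    is_functor_comp_funct[OF F is_functor_comp_funct[OF G H]]
  by (rule functor_eqI) (simp_all add: functor_obj[OF F] functor_arr[OF F])

lemma comp_funct_id_right:
  assumes F: "is_functor A B F"
  shows "comp_funct A F (id_funct A) = F"
  using is_functor_comp_funct[OF is_functor_id_funct[OF functor_cat(1)[OF F]] F] F
  by (rule functor_eqI) simp_all

lemma comp_funct_id_left:
  assumes F: "is_functor A B F"
  shows "comp_funct A (id_funct B) F = F"
  using is_functor_comp_funct[OF F is_functor_id_funct[OF functor_cat(2)[OF F]]] F
  by (rule functor_eqI) (simp_all add: functor_obj[OF F] functor_arr[OF F])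

section \<open>Natural transformations: identities, pasting and whiskering\<close>

lemma nat_trans_hom: "nat_trans A B F G \<tau> \<Longrightarrow> x \<in> Obj A \<Longrightarrow> \<tau> x \<in> hom B (FO F x) (FO G x)"
  by (auto simp: nat_trans_def)

lemma nat_trans_natural:
  "nat_trans A B F G \<tau> \<Longrightarrow> f \<in> hom A x y \<Longrightarrow> Comp B (FA G f) (\<tau> x) = Comp B (\<tau> y) (FA F f)"
  by (auto simp: nat_trans_def hom_def)

lemma nat_transI:
  assumes "is_functor A B F" "is_functor A B G" "\<tau> \<in> extensional (Obj A)"
    and "\<And>x. x \<in> Obj A \<Longrightarrow> \<tau> x \<in> hom B (FO F x) (FO G x)"
    and "\<And>f x y. f \<in> hom A x y \<Longrightarrow> Comp B (FA G f) (\<tau> x) = Comp B (\<tau> y) (FA F f)"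
  shows "nat_trans A B F G \<tau>"
  using assms by (auto simp: nat_trans_def hom_def)

lemma nat_trans_id:
  assumes F: "is_functor A B F"
  shows "nat_trans A B F F (\<lambda>x\<in>Obj A. Ide B (FO F x))"
proof -
  interpret A: category A using functor_cat F by blast
  interpret B: category B using functor_cat F by blast
  show ?thesis
  proof (rule nat_transI[OF F F])
    show "Comp B (FA F f) ((\<lambda>x\<in>Obj A. Ide B (FO F x)) x) =
        Comp B ((\<lambda>x\<in>Obj A. Ide B (FO F x)) y) (FA F f)" if f: "f \<in> hom A x y" for f x y
      using A.hom_objs[OF f] functor_hom[OF F f] by (simp add: B.Comp_Id_left B.Comp_Id_right)
  qed (use functor_obj[OF F] B.Id_hom in auto)
qed

text \<open>The naturality square at \<open>f\<close> is the square of \<sigma> at \<open>f\<close>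
  glued to the square of \<tau> at \<open>FA R f\<close>. The bracketing of the target functor
  matches the shape of a composite in \<open>Diag_right\<close>.\<close>

lemma nat_trans_paste:
  assumes R: "is_functor J J' R" and S: "is_functor J' J'' S" and D'': "is_functor J'' C D''"
    and \<sigma>: "nat_trans J C D (comp_funct J D' R) \<sigma>"
    and \<tau>: "nat_trans J' C D' (comp_funct J' D'' S) \<tau>"
  shows "nat_trans J C D (comp_funct J D'' (comp_funct J S R))
    (\<lambda>j\<in>Obj J. Comp C (\<tau> (FO R j)) (\<sigma> j))"
proof -
  have D: "is_functor J C D" and D': "is_functor J' C D'"
    using \<sigma> \<tau> by (auto simp: nat_trans_def)
  interpret J: category J using functor_cat D by blast
  interpret C: category C using functor_cat D by blast
  have \<sigma>h: "\<sigma> j \<in> hom C (FO D j) (FO D' (FO R j))" if "j \<in> Obj J" for j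
    using nat_trans_hom[OF \<sigma> that] that by simp
  have \<tau>h: "\<tau> (FO R j) \<in> hom C (FO D' (FO R j)) (FO D'' (FO S (FO R j)))" if "j \<in> Obj J" for j
    using nat_trans_hom[OF \<tau> functor_obj[OF R that]] functor_obj[OF R that] by simp
  show ?thesis
  proof (rule nat_transI)
    show "is_functor J C D" "is_functor J C (comp_funct J D'' (comp_funct J S R))"
      using D is_functor_comp_funct[OF is_functor_comp_funct[OF R S] D''] by auto
    show "(\<lambda>j\<in>Obj J. Comp C (\<tau> (FO R j)) (\<sigma> j)) x
        \<in> hom C (FO D x) (FO (comp_funct J D'' (comp_funct J S R)) x)" if "x \<in> Obj J" for x
      using C.Comp_hom[OF \<sigma>h \<tau>h] that by simp
  next
    fix f x y assume f: "f \<in> hom J x y"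
    note x = J.hom_objs(1)[OF f] and y = J.hom_objs(2)[OF f] and fA = homD(1)[OF f]
    have Rf: "FA R f \<in> hom J' (FO R x) (FO R y)" by (rule functor_hom[OF R f])
    note D'Rf = functor_hom[OF D' Rf] and RfA = homD(1)[OF Rf]
    have SRf: "FA D'' (FA S (FA R f)) \<in> hom C (FO D'' (FO S (FO R x))) (FO D'' (FO S (FO R y)))"
      by (intro functor_hom[OF D''] functor_hom[OF S] Rf)
    have "Comp C (FA D'' (FA S (FA R f))) (Comp C (\<tau> (FO R x)) (\<sigma> x)) =
        Comp C (Comp C (FA D'' (FA S (FA R f))) (\<tau> (FO R x))) (\<sigma> x)"
      using C.Comp_assoc[OF \<sigma>h[OF x] \<tau>h[OF x] SRf] .
    also have "\<dots> = Comp C (Comp C (\<tau> (FO R y)) (FA D' (FA R f))) (\<sigma> x)"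
      using nat_trans_natural[OF \<tau> Rf] RfA by simp
    also have "\<dots> = Comp C (\<tau> (FO R y)) (Comp C (FA D' (FA R f)) (\<sigma> x))"
      using C.Comp_assoc[OF \<sigma>h[OF x] D'Rf \<tau>h[OF y]] by simp
    also have "\<dots> = Comp C (\<tau> (FO R y)) (Comp C (\<sigma> y) (FA D f))"
      using nat_trans_natural[OF \<sigma> f] fA by simp
    also have "\<dots> = Comp C (Comp C (\<tau> (FO R y)) (\<sigma> y)) (FA D f)"
      using C.Comp_assoc[OF functor_hom[OF D f] \<sigma>h[OF y] \<tau>h[OF y]] .
    finally show "Comp C (FA (comp_funct J D'' (comp_funct J S R)) f)
        ((\<lambda>j\<in>Obj J. Comp C (\<tau> (FO R j)) (\<sigma> j)) x) =
      Comp C ((\<lambda>j\<in>Obj J. Comp C (\<tau> (FO R j)) (\<sigma> j)) y) (FA D f)"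
      using x y fA by simp
  qed simp
qed

lemma nat_trans_whisker:
  assumes F: "is_functor E C F" and \<sigma>: "nat_trans J E D D' \<sigma>"
  shows "nat_trans J C (comp_funct J F D) (comp_funct J F D') (\<lambda>j\<in>Obj J. FA F (\<sigma> j))"
proof -
  have D: "is_functor J E D" and D': "is_functor J E D'"
    using \<sigma> by (auto simp: nat_trans_def)
  interpret J: category J using functor_cat D by blast
  show ?thesis
  proof (rule nat_transI)
    show "is_functor J C (comp_funct J F D)" "is_functor J C (comp_funct J F D')"
      using is_functor_comp_funct[OF D F] is_functor_comp_funct[OF D' F] .
    show "(\<lambda>j\<in>Obj J. FA F (\<sigma> j)) x \<in> hom C (FO (comp_funct J F D) x) (FO (comp_funct J F D') x)"
      if "x \<in> Obj J" for x
      using functor_hom[OF F nat_trans_hom[OF \<sigma> that]] that by simp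
  next
    fix f x y assume f: "f \<in> hom J x y"
    note x = J.hom_objs(1)[OF f] and y = J.hom_objs(2)[OF f] and fA = homD(1)[OF f]
    show "Comp C (FA (comp_funct J F D') f) ((\<lambda>j\<in>Obj J. FA F (\<sigma> j)) x) =
      Comp C ((\<lambda>j\<in>Obj J. FA F (\<sigma> j)) y) (FA (comp_funct J F D) f)"
      using x y fA nat_trans_natural[OF \<sigma> f]
        functor_comp[OF F nat_trans_hom[OF \<sigma> x] functor_hom[OF D' f]]
        functor_comp[OF F functor_hom[OF D f] nat_trans_hom[OF \<sigma> y]]
      by simp
  qed simp
qed

section \<open>The category of diagrams\<close>

lemma diag_right_arrs_iff:
  "m \<in> diag_right_arrs C \<longleftrightarrow>
    is_functor (fst (Src m)) C (snd (Src m)) \<and> is_functor (fst (Tgt m)) C (snd (Tgt m)) \<and>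
    is_functor (fst (Src m)) (fst (Tgt m)) (Shape m) \<and>
    nat_trans (fst (Src m)) C (snd (Src m)) (comp_funct (fst (Src m)) (snd (Tgt m)) (Shape m))
      (Trans m)"
  by (cases m) (auto simp: diag_right_arrs_def)

lemma diagrams_iff: "X \<in> diagrams C \<longleftrightarrow> is_functor (fst X) C (snd X)"
  by (auto simp: diagrams_def)

lemma diag_right_arrsD:
  assumes "m \<in> diag_right_arrs C"
  shows "is_functor (fst (Src m)) C (snd (Src m))" "is_functor (fst (Tgt m)) C (snd (Tgt m))"
    "is_functor (fst (Src m)) (fst (Tgt m)) (Shape m)"
    "nat_trans (fst (Src m)) C (snd (Src m)) (comp_funct (fst (Src m)) (snd (Tgt m)) (Shape m))
      (Trans m)"
    "Trans m \<in> extensional (Obj (fst (Src m)))"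
    "j \<in> Obj (fst (Src m)) \<Longrightarrow>
      Trans m j \<in> hom C (FO (snd (Src m)) j) (FO (snd (Tgt m)) (FO (Shape m) j))"
  using assms nat_trans_hom[of "fst (Src m)" C "snd (Src m)" _ "Trans m" j]
  by (auto simp: diag_right_arrs_iff nat_trans_def)

lemma Diag_right_simps [simp]:
  "Obj (Diag_right C) = diagrams C"
  "Arr (Diag_right C) = diag_right_arrs C"
  "m \<in> diag_right_arrs C \<Longrightarrow> Dom (Diag_right C) m = Src m"
  "m \<in> diag_right_arrs C \<Longrightarrow> Cod (Diag_right C) m = Tgt m"
  "X \<in> diagrams C \<Longrightarrow> Ide (Diag_right C) X = diag_id C X"
  by (simp_all add: Diag_right_def)

lemma Comp_Diag_right:
  assumes "m \<in> diag_right_arrs C" "n \<in> diag_right_arrs C" "Src n = Tgt m"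
  shows "Comp (Diag_right C) n m =
    \<lparr>Src = Src m, Tgt = Tgt n, Shape = comp_funct (fst (Src m)) (Shape n) (Shape m),
     Trans = (\<lambda>j\<in>Obj (fst (Src m)). Comp C (Trans n (FO (Shape m) j)) (Trans m j))\<rparr>"
  using assms by (simp add: Diag_right_def Let_def)

lemma hom_Diag_right:
  "m \<in> hom (Diag_right C) X Y \<longleftrightarrow> m \<in> diag_right_arrs C \<and> Src m = X \<and> Tgt m = Y"
  by (auto simp: hom_def)

lemma diag_id_simps [simp]:
  "Src (diag_id C X) = X" "Tgt (diag_id C X) = X" "Shape (diag_id C X) = id_funct (fst X)"
  "Trans (diag_id C X) = (\<lambda>j\<in>Obj (fst X). Ide C (FO (snd X) j))"
  by (simp_all add: diag_id_def split_beta)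

lemma Comp_Diag_right_arr:
  assumes mn: "m \<in> diag_right_arrs C" "n \<in> diag_right_arrs C" "Src n = Tgt m"
  shows "Comp (Diag_right C) n m \<in> diag_right_arrs C"
proof -
  note m = diag_right_arrsD[OF mn(1)] and n = diag_right_arrsD[OF mn(2), unfolded mn(3)]
  show ?thesis
    using m(1) n(2) is_functor_comp_funct[OF m(3) n(3)]
      nat_trans_paste[OF m(3) n(3) n(2) m(4) n(4)] mn
    by (simp add: Comp_Diag_right diag_right_arrs_iff)
qed

lemma diag_id_arr:
  assumes "X \<in> diagrams C"
  shows "diag_id C X \<in> diag_right_arrs C"
  using assms functor_cat[of "fst X" C "snd X"]
  by (simp add: diag_right_arrs_iff diagrams_iff is_functor_id_funct comp_funct_id_right nat_trans_id)

text \<open>\<open>discrete_opfibration_at\<close> asks for a functor between diagram categories,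
  and \<open>is_functor\<close> includes that both ends are categories. The laws hold componentwise
  in \<open>C\<close> for transformations; for shapes they are the laws of functor
  composition.\<close>

lemma category_Diag_right:
  assumes "category C"
  shows "category (Diag_right C :: (('jo, 'jm, 'o, 'm) diagram, ('jo, 'jm, 'o, 'm) diag_arr) cat)"
    (is "category ?D")
proof
  interpret C: category C by fact
  show "Dom ?D \<in> Arr ?D \<rightarrow>\<^sub>E Obj ?D" "Cod ?D \<in> Arr ?D \<rightarrow>\<^sub>E Obj ?D"
    by (auto simp: Diag_right_def diag_right_arrs_iff diagrams_iff)
  show "Ide ?D \<in> extensional (Obj ?D)"
    by (simp add: Diag_right_def)
  fix m n k :: "('jo, 'jm, 'o, 'm) diag_arr" and X Y Z W :: "('jo, 'jm, 'o, 'm) diagram"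
  show "Ide ?D X \<in> hom ?D X X" if "X \<in> Obj ?D"
    using that diag_id_arr[of X C] by (simp add: hom_Diag_right)
  show "Comp ?D n m \<in> hom ?D X Z" if "m \<in> hom ?D X Y" "n \<in> hom ?D Y Z"
    using that Comp_Diag_right_arr[of m C n] by (auto simp: hom_Diag_right Comp_Diag_right)
  show "Comp ?D n m = undefined" if "\<not> (m \<in> Arr ?D \<and> n \<in> Arr ?D \<and> Dom ?D n = Cod ?D m)"
    using that by (auto simp: Diag_right_def)
  show "Comp ?D m (Ide ?D X) = m" if "m \<in> hom ?D X Y"
  proof -
    have m: "m \<in> diag_right_arrs C" "Src m = X" using that by (auto simp: hom_Diag_right)
    note mD = diag_right_arrsD[OF m(1), unfolded m(2)]
    have X: "X \<in> diagrams C" "diag_id C X \<in> diag_right_arrs C"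
      using mD(1) diag_id_arr[of X C] by (auto simp: diagrams_iff)
    \<comment> \<open>Both sides are \<open>undefined\<close> off the objects of the shape, so the
      unit law of \<open>C\<close> at each \<open>j\<close> suffices.\<close>
    have "(\<lambda>j\<in>Obj (fst X). Comp C (Trans m (FO (id_funct (fst X)) j))
        ((\<lambda>j\<in>Obj (fst X). Ide C (FO (snd X) j)) j)) = Trans m"
      using mD(5) C.Comp_Id_right[OF mD(6)]
      by (intro extensionalityI[of _ "Obj (fst X)"]) (auto)
    then show ?thesis
      using X m mD(3) by (simp add: Comp_Diag_right comp_funct_id_right)
  qed
  show "Comp ?D (Ide ?D Y) m = m" if "m \<in> hom ?D X Y"
  proof -
    have m: "m \<in> diag_right_arrs C" "Tgt m = Y" using that by (auto simp: hom_Diag_right)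
    note mD = diag_right_arrsD[OF m(1), unfolded m(2)]
    have Y: "Y \<in> diagrams C" "diag_id C Y \<in> diag_right_arrs C"
      using mD(2) diag_id_arr[of Y C] by (auto simp: diagrams_iff)
    have "(\<lambda>j\<in>Obj (fst (Src m)). Comp C ((\<lambda>j\<in>Obj (fst Y). Ide C (FO (snd Y) j)) (FO (Shape m) j))
        (Trans m j)) = Trans m"
      using mD(5) C.Comp_Id_left[OF mD(6)] functor_obj[OF mD(3)]
      by (intro extensionalityI[of _ "Obj (fst (Src m))"]) (auto)
    then show ?thesis
      using Y m mD(3) by (simp add: Comp_Diag_right comp_funct_id_left)
  qed
  show "Comp ?D k (Comp ?D n m) = Comp ?D (Comp ?D k n) m"
    if "m \<in> hom ?D W X" "n \<in> hom ?D X Y" "k \<in> hom ?D Y Z"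
  proof -
    have mem: "m \<in> diag_right_arrs C" "n \<in> diag_right_arrs C" "k \<in> diag_right_arrs C"
      and eq: "Src n = Tgt m" "Src k = Tgt n"
      using that by (auto simp: hom_Diag_right)
    note m = diag_right_arrsD[OF mem(1)] and n = diag_right_arrsD[OF mem(2), unfolded eq]
      and k = diag_right_arrsD[OF mem(3), unfolded eq]
    have "Comp C (Trans k (FO (Shape n) (FO (Shape m) j)))
        (Comp C (Trans n (FO (Shape m) j)) (Trans m j)) =
      Comp C (Comp C (Trans k (FO (Shape n) (FO (Shape m) j))) (Trans n (FO (Shape m) j))) (Trans m j)"
      if j: "j \<in> Obj (fst (Src m))" for j
      using C.Comp_assoc[OF m(6)[OF j] n(6)[OF functor_obj[OF m(3) j]]
          k(6)[OF functor_obj[OF n(3) functor_obj[OF m(3) j]]]] .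
    then show ?thesis
      using mem eq Comp_Diag_right_arr[OF mem(1,2) eq(1)] Comp_Diag_right_arr[OF mem(2,3) eq(2)]
        comp_funct_assoc[OF m(3) n(3) k(3)] functor_obj[OF m(3)]
      by (simp add: Comp_Diag_right cong: restrict_cong)
  qed
qed

section \<open>The functor between diagram categories induced by a functor\<close>

lemma FO_Diag_right_map:
  "X \<in> diagrams E \<Longrightarrow> FO (Diag_right_map E F) X = (fst X, comp_funct (fst X) F (snd X))"
  by (simp add: Diag_right_map_def Let_def split_beta)

lemma FA_Diag_right_map:
  "m \<in> diag_right_arrs E \<Longrightarrow> FA (Diag_right_map E F) m =
    \<lparr>Src = (fst (Src m), comp_funct (fst (Src m)) F (snd (Src m))),
     Tgt = (fst (Tgt m), comp_funct (fst (Tgt m)) F (snd (Tgt m))),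
     Shape = Shape m, Trans = (\<lambda>j\<in>Obj (fst (Src m)). FA F (Trans m j))\<rparr>"
  by (simp add: Diag_right_map_def Let_def split_beta)

text \<open>Whiskering produces the target \<open>F\<close> after (\<open>D'\<close> after
  \<open>R\<close>), while an arrow of diagrams needs (\<open>F\<close> after \<open>D'\<close>)
  after \<open>R\<close>; \<open>comp_funct_assoc\<close> rebrackets.\<close>

lemma FA_Diag_right_map_arr:
  assumes F: "is_functor E C F" and mem: "m \<in> diag_right_arrs E"
  shows "FA (Diag_right_map E F) m \<in> diag_right_arrs C"
proof -
  note m = diag_right_arrsD[OF mem]
  show ?thesis
    using is_functor_comp_funct[OF m(1) F] is_functor_comp_funct[OF m(2) F] m(3)
      nat_trans_whisker[OF F m(4)] comp_funct_assoc[OF m(3) m(2) F] mem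
    by (simp add: FA_Diag_right_map diag_right_arrs_iff)
qed

lemma FO_Diag_right_map_obj:
  assumes F: "is_functor E C F" and X: "X \<in> diagrams E"
  shows "FO (Diag_right_map E F) X \<in> diagrams C"
  using is_functor_comp_funct[OF _ F, of "fst X" "snd X"] X
  by (simp add: FO_Diag_right_map diagrams_iff)

lemma is_functor_Diag_right_map:
  assumes F: "is_functor E C F"
  shows "is_functor (Diag_right E) (Diag_right C)
    (Diag_right_map E F :: (('jo, 'jm, 'e, 'f) diagram, _, ('jo, 'jm, 'o, 'm) diagram, _) funct)"
    (is "is_functor ?E ?C ?F")
proof (rule is_functorI)
  show "category ?E" "category ?C"
    using functor_cat[OF F] category_Diag_right by blast+
  show "FO ?F \<in> extensional (Obj ?E)" "FA ?F \<in> extensional (Arr ?E)"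
    by (simp_all add: Diag_right_map_def Let_def)
  fix X Y Z :: "('jo, 'jm, 'e, 'f) diagram" and m n :: "('jo, 'jm, 'e, 'f) diag_arr"
  show "FO ?F X \<in> Obj ?C" if "X \<in> Obj ?E"
    using that FO_Diag_right_map_obj[OF F] by simp
  show "FA ?F (Ide ?E X) = Ide ?C (FO ?F X)" if "X \<in> Obj ?E"
  proof -
    have X: "X \<in> diagrams E" using that by simp
    then have XF: "is_functor (fst X) E (snd X)" by (simp add: diagrams_iff)
    show ?thesis
      using X functor_id[OF F functor_obj[OF XF]] FO_Diag_right_map_obj[OF F X]
      by (intro diag_arr.equality)
        (auto simp: FO_Diag_right_map FA_Diag_right_map diag_id_arr intro!: restrict_ext)
  qed
  assume mh: "m \<in> hom ?E X Y"
  then have mem: "m \<in> diag_right_arrs E" and X: "Src m = X" and Y: "Tgt m = Y"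
    by (auto simp: hom_Diag_right)
  note m = diag_right_arrsD[OF mem, unfolded X Y]
  show "FA ?F m \<in> hom ?C (FO ?F X) (FO ?F Y)"
    using FA_Diag_right_map_arr[OF F mem] mem X Y m(1,2)
    by (simp add: hom_Diag_right FA_Diag_right_map FO_Diag_right_map diagrams_iff)
  assume nh: "n \<in> hom ?E Y Z"
  then have nem: "n \<in> diag_right_arrs E" and Yn: "Src n = Y" and Z: "Tgt n = Z"
    by (auto simp: hom_Diag_right)
  note n = diag_right_arrsD[OF nem, unfolded Yn Z]
  \<comment> \<open>The induced functor leaves shapes alone, so preservation of composites comes
    down to this equation of components.\<close>
  have "FA F (Comp E (Trans n (FO (Shape m) j)) (Trans m j)) =
      Comp C (FA F (Trans n (FO (Shape m) j))) (FA F (Trans m j))" if j: "j \<in> Obj (fst X)" for j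
    using functor_comp[OF F m(6)[OF j] n(6)[OF functor_obj[OF m(3) j]]] .
  then show "FA ?F (Comp ?E n m) = Comp ?C (FA ?F n) (FA ?F m)"
    using Comp_Diag_right_arr[OF mem nem] FA_Diag_right_map_arr[OF F mem]
      FA_Diag_right_map_arr[OF F nem] mem nem X Y Yn Z functor_obj[OF m(3)]
    by (auto simp: Comp_Diag_right FA_Diag_right_map intro!: restrict_ext)
qed

section \<open>Lifting along a discrete opfibration\<close>

locale opfibration =
  fixes E :: "('e, 'f) cat" and C :: "('o, 'm) cat" and \<pi> :: "('e, 'f, 'o, 'm) funct"
  assumes opfib: "discrete_opfibration E C \<pi>"
begin

lemma proj: "is_functor E C \<pi>"
  using opfib by (simp add: discrete_opfibration_def)

sublocale E: category E using functor_cat[OF proj] by blast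
sublocale C: category C using functor_cat[OF proj] by blast

text \<open>Meaningful only for \<open>x\<close> over the domain of \<open>f\<close>, where
  \<open>ex1_lift\<close> makes the description unique.\<close>

definition lift :: "'e \<Rightarrow> 'm \<Rightarrow> 'f" where
  "lift x f = (THE g. g \<in> Arr E \<and> Dom E g = x \<and> FA \<pi> g = f)"

text \<open>The action of \<open>f\<close> on fibres, in the correspondence of discrete opfibrations
  over \<open>C\<close> with set-valued functors on \<open>C\<close>.\<close>

definition push :: "'e \<Rightarrow> 'm \<Rightarrow> 'e" where
  "push x f = Cod E (lift x f)"

lemma ex1_lift:
  assumes "x \<in> Obj E" "f \<in> hom C (FO \<pi> x) y"
  shows "\<exists>!g. g \<in> Arr E \<and> Dom E g = x \<and> FA \<pi> g = f"
  using assms opfib homD[OF assms(2)]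
  unfolding discrete_opfibration_def discrete_opfibration_at_def by auto

lemma lift_hom:
  assumes "x \<in> Obj E" "f \<in> hom C (FO \<pi> x) y"
  shows "lift x f \<in> hom E x (push x f)" "FA \<pi> (lift x f) = f"
  using theI'[OF ex1_lift[OF assms]] unfolding lift_def push_def hom_def by auto

text \<open>By uniqueness every arrow of \<open>E\<close> is the chosen lift of its own image.
  Equalities in \<open>E\<close> are reduced to equalities in \<open>C\<close> through this
  lemma.\<close>

lemma lift_eq:
  assumes g: "g \<in> hom E x z" and f: "FA \<pi> g = f"
  shows "lift x f = g" "push x f = z"
proof -
  have "f \<in> hom C (FO \<pi> x) (FO \<pi> z)"
    using functor_hom[OF proj g] f by simp
  then show "lift x f = g"
    using ex1_lift[OF E.hom_objs(1)[OF g]] homD[OF g] f unfolding lift_def by blast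
  then show "push x f = z"
    using homD[OF g] by (simp add: push_def)
qed

lemma push_obj:
  assumes "x \<in> Obj E" "f \<in> hom C (FO \<pi> x) y"
  shows "push x f \<in> Obj E" "FO \<pi> (push x f) = y"
  using E.hom_objs(2)[OF lift_hom(1)[OF assms]] homD(3)[OF assms(2)] lift_hom(2)[OF assms]
    homD(3)[OF functor_hom[OF proj lift_hom(1)[OF assms]]] by auto

lemma lift_id:
  assumes "x \<in> Obj E"
  shows "lift x (Ide C (FO \<pi> x)) = Ide E x" "push x (Ide C (FO \<pi> x)) = x"
  using lift_eq[OF E.Id_hom[OF assms] functor_id[OF proj assms]] .

text \<open>The composite of the two lifts starts at \<open>x\<close> and lies over the composite,
  so \<open>lift_eq\<close> applies. The second part is functoriality of transport.\<close>

lemma lift_comp: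
  assumes x: "x \<in> Obj E" and f: "f \<in> hom C (FO \<pi> x) y" and g: "g \<in> hom C y z"
  shows "lift x (Comp C g f) = Comp E (lift (push x f) g) (lift x f)"
    "push x (Comp C g f) = push (push x f) g"
proof -
  note F = lift_hom[OF x f] and p = push_obj[OF x f]
  \<comment> \<open>Folding with \<open>p(2)\<close> presents \<open>g\<close> as an arrow out of
    the image of \<open>push x f\<close>, as needed to lift it there.\<close>
  note G = lift_hom[OF p(1) g[folded p(2)]]
  have "FA \<pi> (Comp E (lift (push x f) g) (lift x f)) = Comp C g f"
    using functor_comp[OF proj F(1) G(1)] F(2) G(2) by simp
  from lift_eq[OF E.Comp_hom[OF F(1) G(1)] this]
  show "lift x (Comp C g f) = Comp E (lift (push x f) g) (lift x f)"
    "push x (Comp C g f) = push (push x f) g" .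
qed

end

section \<open>Pushforward of a lifted diagram along a relatively initial morphism\<close>

locale pushforward = opfibration E C \<pi>
  for E :: "('e, 'f) cat" and C :: "('o, 'm) cat" and \<pi> :: "('e, 'f, 'o, 'm) funct" +
  fixes J J' :: "('jo, 'jm) cat" and D D' :: "('jo, 'jm, 'o, 'm) funct"
    and R :: "('jo, 'jm, 'jo, 'jm) funct" and \<rho> :: "'jo \<Rightarrow> 'm"
    and X :: "('jo, 'jm, 'e, 'f) funct" and m :: "('jo, 'jm, 'o, 'm) diag_arr"
  defines m_def: "m \<equiv> \<lparr>Src = (J, D), Tgt = (J', D'), Shape = R, Trans = \<rho>\<rparr>"
  assumes initial: "relatively_initial C m"
    and X: "is_functor J E X"
    and X_over: "comp_funct J \<pi> X = D"
begin

lemma m_arr: "m \<in> diag_right_arrs C"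
  using initial by (simp add: relatively_initial_def)

lemmas m_D = diag_right_arrsD[OF m_arr, unfolded m_def, simplified]

lemma D: "is_functor J C D" and D': "is_functor J' C D'" and R: "is_functor J J' R"
  and \<rho>_nat: "nat_trans J C D (comp_funct J D' R) \<rho>" and \<rho>_ext: "\<rho> \<in> extensional (Obj J)"
  using m_D by auto

lemma \<rho>_hom: "j \<in> Obj J \<Longrightarrow> \<rho> j \<in> hom C (FO D j) (FO D' (FO R j))"
  using m_D(6) .

sublocale J: category J using functor_cat[OF D] by blast
sublocale J': category J' using functor_cat[OF D'] by blast

lemma D_obj: "j \<in> Obj J \<Longrightarrow> FO \<pi> (FO X j) = FO D j"
  and D_arr: "h \<in> Arr J \<Longrightarrow> FA \<pi> (FA X h) = FA D h"
  unfolding X_over[symmetric] by simp_all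

text \<open>The candidate value at the codomain \<open>j'\<close> of \<open>f'\<close>, as computed
  from one object of the slice over \<open>j'\<close>.\<close>

definition slice_push :: "'jo \<Rightarrow> 'jm \<Rightarrow> 'e" where
  "slice_push j f' = push (FO X j) (Comp C (FA D' f') (\<rho> j))"

lemma slice_hom:
  assumes "j \<in> Obj J" "f' \<in> hom J' (FO R j) j'"
  shows "Comp C (FA D' f') (\<rho> j) \<in> hom C (FO \<pi> (FO X j)) (FO D' j')"
  using C.Comp_hom[OF \<rho>_hom functor_hom[OF D']] assms D_obj by simp

lemma slice_push_obj:
  assumes "j \<in> Obj J" "f' \<in> hom J' (FO R j) j'"
  shows "slice_push j f' \<in> Obj E" "FO \<pi> (slice_push j f') = FO D' j'"
  using push_obj[OF functor_obj[OF X assms(1)] slice_hom[OF assms]] unfolding slice_push_def .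

text \<open>The equation defining arrows of the slice lets \<open>D h\<close> be split off on the
  right; functoriality of transport then moves \<open>X j\<close> along \<open>D h\<close>
  first.\<close>

lemma slice_push_arr:
  assumes j: "j \<in> Obj J" and k: "k \<in> Obj J"
    and g': "g' \<in> hom J' (FO R k) j'" and h: "h \<in> hom J j k"
    and eq: "Comp C (FA D' f') (\<rho> j) = Comp C (FA D' g') (Comp C (\<rho> k) (FA D h))"
  shows "slice_push j f' = slice_push k g'"
proof -
  have Dh: "FA D h \<in> hom C (FO \<pi> (FO X j)) (FO D k)"
    using functor_hom[OF D h] j by (simp add: D_obj)
  have "slice_push j f' = push (FO X j) (Comp C (Comp C (FA D' g') (\<rho> k)) (FA D h))"
    using C.Comp_assoc[OF functor_hom[OF D h] \<rho>_hom[OF k] functor_hom[OF D' g']] eq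
    by (simp add: slice_push_def)
  also have "\<dots> = push (push (FO X j) (FA D h)) (Comp C (FA D' g') (\<rho> k))"
    using lift_comp(2)[OF functor_obj[OF X j] Dh] slice_hom[OF k g'] k by (simp add: D_obj)
  \<comment> \<open>\<open>X h\<close> starts at \<open>X j\<close> and lies over
    \<open>D h\<close>, so the transport ends where \<open>X h\<close> ends.\<close>
  also have "push (FO X j) (FA D h) = FO X k"
    using lift_eq(2)[OF functor_hom[OF X h]] D_arr homD(1)[OF h] by simp
  finally show ?thesis by (simp add: slice_push_def)
qed

text \<open>Connectedness joins the two slice objects by a zig-zag, and no leg of it changes the
  transport.\<close>

lemma slice_push_const:
  assumes j: "j \<in> Obj J" "f' \<in> hom J' (FO R j) j'" and k: "k \<in> Obj J" "g' \<in> hom J' (FO R k) j'"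
  shows "slice_push j f' = slice_push k g'"
proof -
  \<comment> \<open>The one-step relation inside the \<open>let\<close> of
    \<open>connected_cat\<close>, named for the induction over its closure.\<close>
  define S where "S = {(Dom (rel_slice C m j') a, Cod (rel_slice C m j') a) |a. a \<in> Arr (rel_slice C m j')}"
  have objs: "p \<in> rel_slice_objs m j' \<longleftrightarrow> fst p \<in> Obj J \<and> snd p \<in> hom J' (FO R (fst p)) j'" for p
    by (cases p) (simp add: rel_slice_objs_def m_def)
  have along: "slice_push (fst p) (snd p) = slice_push (fst q) (snd q)" if pq: "(p, q) \<in> S" for p q
  proof -
    obtain h where "(p, h, q) \<in> rel_slice_arrs C m j'"
      using pq by (auto simp: S_def rel_slice_def Let_def)
    then show ?thesis
      using slice_push_arr[of "fst p" "fst q" "snd q" j' h "snd p"]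
      unfolding rel_slice_arrs_def by (auto simp: m_def rel_slice_objs_def)
  qed
  have j': "j' \<in> Obj J'" using J'.hom_objs(2)[OF j(2)] .
  then have "connected_cat (rel_slice C m j')"
    using initial by (simp add: relatively_initial_def m_def)
  then have "((j, f'), (k, g')) \<in> (S \<union> S\<inverse>)\<^sup>*"
    using j k by (auto simp: connected_cat_def S_def Let_def rel_slice_def objs)
  then have "slice_push (fst (j, f')) (snd (j, f')) = slice_push (fst (k, g')) (snd (k, g'))"
  proof (induction rule: rtrancl_induct)
    case (step y z)
    \<comment> \<open>The leg may run along an arrow in either direction, hence both instances of
      \<open>along\<close>.\<close>
    then have "slice_push (fst y) (snd y) = slice_push (fst z) (snd z)"
      using along[of y z] along[of z y] by auto
    with step.IH show ?case by simp
  qed simp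
  then show ?thesis by simp
qed

text \<open>The common value over all objects of the slice, so that no representative is chosen.
  \<open>slice_nonempty\<close> supplies a value, \<open>slice_push_const\<close> its
  uniqueness.\<close>

definition pushed_obj :: "'jo \<Rightarrow> 'e" where
  "pushed_obj j' = (THE e. \<exists>j f'. j \<in> Obj J \<and> f' \<in> hom J' (FO R j) j' \<and> e = slice_push j f')"

lemma pushed_obj_eq:
  assumes "j \<in> Obj J" "f' \<in> hom J' (FO R j) j'"
  shows "pushed_obj j' = slice_push j f'"
  unfolding pushed_obj_def using assms slice_push_const by (intro the_equality) blast+

lemma slice_nonempty:
  assumes "j' \<in> Obj J'"
  obtains j f' where "j \<in> Obj J" "f' \<in> hom J' (FO R j) j'"
proof -
  have "rel_slice_objs m j' \<noteq> {}"
    using initial assms by (simp add: relatively_initial_def m_def rel_slice_def Let_def)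
  then show ?thesis
    using that by (auto simp: m_def rel_slice_objs_def)
qed

lemma pushed_obj:
  assumes "j' \<in> Obj J'"
  shows "pushed_obj j' \<in> Obj E" "FO \<pi> (pushed_obj j') = FO D' j'"
  using slice_nonempty[OF assms] slice_push_obj pushed_obj_eq by metis+

text \<open>If \<open>j\<close> and \<open>f'\<close> represent \<open>j'\<close>, then
  \<open>j\<close> and \<open>g\<close> after \<open>f'\<close> represent \<open>k'\<close>, and
  transport is functorial. This fixes the codomains of lifted arrows.\<close>

lemma push_pushed_obj:
  assumes g: "g \<in> hom J' j' k'"
  shows "push (pushed_obj j') (FA D' g) = pushed_obj k'"
proof -
  obtain j f' where j: "j \<in> Obj J" and f': "f' \<in> hom J' (FO R j) j'"
    using slice_nonempty[OF J'.hom_objs(1)[OF g]] .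
  have "pushed_obj k' = push (FO X j) (Comp C (FA D' (Comp J' g f')) (\<rho> j))"
    using pushed_obj_eq[OF j J'.Comp_hom[OF f' g]] by (simp add: slice_push_def)
  also have "\<dots> = push (FO X j) (Comp C (FA D' g) (Comp C (FA D' f') (\<rho> j)))"
    using functor_comp[OF D' f' g]
      C.Comp_assoc[OF \<rho>_hom[OF j] functor_hom[OF D' f'] functor_hom[OF D' g]] by simp
  also have "\<dots> = push (pushed_obj j') (FA D' g)"
    using lift_comp(2)[OF functor_obj[OF X j] slice_hom[OF j f'] functor_hom[OF D' g]]
      pushed_obj_eq[OF j f'] by (simp add: slice_push_def)
  finally show ?thesis by simp
qed

definition pushed :: "('jo, 'jm, 'e, 'f) funct" where
  "pushed = \<lparr>FO = (\<lambda>j'\<in>Obj J'. pushed_obj j'),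
     FA = (\<lambda>g\<in>Arr J'. lift (pushed_obj (Dom J' g)) (FA D' g))\<rparr>"

lemma FO_pushed: "j' \<in> Obj J' \<Longrightarrow> FO pushed j' = pushed_obj j'"
  and FA_pushed: "g \<in> hom J' j' k' \<Longrightarrow> FA pushed g = lift (pushed_obj j') (FA D' g)"
  by (simp_all add: pushed_def hom_def)

lemma FA_pushed_hom:
  assumes g: "g \<in> hom J' j' k'"
  shows "FA pushed g \<in> hom E (pushed_obj j') (pushed_obj k')" "FA \<pi> (FA pushed g) = FA D' g"
proof -
  note j' = pushed_obj[OF J'.hom_objs(1)[OF g]]
  have "FA D' g \<in> hom C (FO \<pi> (pushed_obj j')) (FO D' k')"
    using functor_hom[OF D' g] j'(2) by simp
  from lift_hom[OF j'(1) this]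
  show "FA pushed g \<in> hom E (pushed_obj j') (pushed_obj k')" "FA \<pi> (FA pushed g) = FA D' g"
    using push_pushed_obj[OF g] FA_pushed[OF g] by simp_all
qed

lemma is_functor_pushed: "is_functor J' E pushed"
proof (rule is_functorI)
  show "FO pushed \<in> extensional (Obj J')" "FA pushed \<in> extensional (Arr J')"
    by (simp_all add: pushed_def)
  show "FO pushed x \<in> Obj E" if "x \<in> Obj J'" for x
    using that pushed_obj by (simp add: FO_pushed)
  show "FA pushed (Ide J' x) = Ide E (FO pushed x)" if x: "x \<in> Obj J'" for x
    using lift_id(1)[OF pushed_obj(1)[OF x], unfolded pushed_obj(2)[OF x]]
    by (simp add: FA_pushed[OF J'.Id_hom[OF x]] functor_id[OF D' x] FO_pushed[OF x])
  fix f g x y z assume f: "f \<in> hom J' x y"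
  note x = J'.hom_objs(1)[OF f] and y = J'.hom_objs(2)[OF f]
  show "FA pushed f \<in> hom E (FO pushed x) (FO pushed y)"
    using FA_pushed_hom(1)[OF f] by (simp add: FO_pushed x y)
  assume g: "g \<in> hom J' y z"
  have "FA D' f \<in> hom C (FO \<pi> (pushed_obj x)) (FO D' y)"
    using functor_hom[OF D' f] pushed_obj(2)[OF x] by simp
  \<comment> \<open>Here the second lift starts at \<open>push (pushed_obj x) (FA D' f)\<close>,
    which \<open>push_pushed_obj\<close> identifies with \<open>pushed_obj y\<close>.\<close>
  from lift_comp(1)[OF pushed_obj(1)[OF x] this functor_hom[OF D' g]]
  show "FA pushed (Comp J' g f) = Comp E (FA pushed g) (FA pushed f)"
    using FA_pushed[OF f] FA_pushed[OF g] FA_pushed[OF J'.Comp_hom[OF f g]]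
      functor_comp[OF D' f g] push_pushed_obj[OF f]
    by simp
qed (fact J'.category_axioms E.category_axioms)+

lemma pushed_over: "comp_funct J' \<pi> pushed = D'"
  using is_functor_comp_funct[OF is_functor_pushed proj] D'
  by (rule functor_eqI)
    (simp_all add: FO_pushed pushed_obj FA_pushed_hom(2)[OF J'.arr_dom_cod(3)])

section \<open>The lifted transformation and the lifted morphism of diagrams\<close>

definition pushed_trans :: "'jo \<Rightarrow> 'f" where
  "pushed_trans = (\<lambda>j\<in>Obj J. lift (FO X j) (\<rho> j))"

lemma \<rho>_hom_over: "j \<in> Obj J \<Longrightarrow> \<rho> j \<in> hom C (FO \<pi> (FO X j)) (FO D' (FO R j))"
  using \<rho>_hom D_obj by simp

text \<open>Uses the slice object formed by \<open>j\<close> and the identity of \<open>R j\<close>,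
  whose transporting arrow reduces to \<rho> at \<open>j\<close>.\<close>

lemma push_\<rho>:
  assumes j: "j \<in> Obj J"
  shows "push (FO X j) (\<rho> j) = pushed_obj (FO R j)"
  using pushed_obj_eq[OF j J'.Id_hom[OF functor_obj[OF R j]]] functor_id[OF D' functor_obj[OF R j]]
    C.Comp_Id_left[OF \<rho>_hom[OF j]]
  by (simp add: slice_push_def)

text \<open>Both sides of a naturality square are lifts at \<open>X x\<close>, of arrows that agree
  by naturality of \<rho>; so they coincide.\<close>

lemma nat_trans_pushed: "nat_trans J E X (comp_funct J pushed R) pushed_trans"
proof (rule nat_transI[OF X is_functor_comp_funct[OF R is_functor_pushed]])
  show "pushed_trans \<in> extensional (Obj J)"
    by (simp add: pushed_trans_def)
  show "pushed_trans x \<in> hom E (FO X x) (FO (comp_funct J pushed R) x)" if x: "x \<in> Obj J" for x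
    using lift_hom(1)[OF functor_obj[OF X x] \<rho>_hom_over[OF x]] x push_\<rho>[OF x] functor_obj[OF R x]
    by (simp add: pushed_trans_def FO_pushed)
  fix f x y assume f: "f \<in> hom J x y"
  note x = J.hom_objs(1)[OF f] and y = J.hom_objs(2)[OF f]
  have Df: "FA D f \<in> hom C (FO \<pi> (FO X x)) (FO \<pi> (FO X y))"
    using functor_hom[OF D f] D_obj x y by simp
  have Xf: "lift (FO X x) (FA D f) = FA X f" "push (FO X x) (FA D f) = FO X y"
    using lift_eq[OF functor_hom[OF X f] D_arr[OF homD(1)[OF f]]] .
  have "Comp E (FA pushed (FA R f)) (lift (FO X x) (\<rho> x)) =
      lift (FO X x) (Comp C (FA D' (FA R f)) (\<rho> x))"
    using lift_comp(1)[OF functor_obj[OF X x] \<rho>_hom_over[OF x]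
        functor_hom[OF D' functor_hom[OF R f]]]
      push_\<rho>[OF x] FA_pushed[OF functor_hom[OF R f]] by simp
  also have "\<dots> = lift (FO X x) (Comp C (\<rho> y) (FA D f))"
    using nat_trans_natural[OF \<rho>_nat f] homD(1)[OF f] by simp
  also have "\<dots> = Comp E (lift (FO X y) (\<rho> y)) (FA X f)"
    using lift_comp(1)[OF functor_obj[OF X x] Df \<rho>_hom_over[OF y]] Xf by simp
  finally show "Comp E (FA (comp_funct J pushed R) f) (pushed_trans x) =
      Comp E (pushed_trans y) (FA X f)"
    using x y homD(1)[OF f] by (simp add: pushed_trans_def)
qed

definition pushed_arr :: "('jo, 'jm, 'e, 'f) diag_arr" where
  "pushed_arr = \<lparr>Src = (J, X), Tgt = (J', pushed), Shape = R, Trans = pushed_trans\<rparr>"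

lemma pushed_arr: "pushed_arr \<in> diag_right_arrs E"
  using X is_functor_pushed R nat_trans_pushed
  by (simp add: pushed_arr_def diag_right_arrs_iff)

lemma pushed_arr_over: "FA (Diag_right_map E \<pi>) pushed_arr = m"
proof -
  have "(\<lambda>j\<in>Obj J. FA \<pi> (pushed_trans j)) = \<rho>"
    using \<rho>_ext lift_hom(2)[OF functor_obj[OF X] \<rho>_hom_over]
    by (intro extensionalityI[of _ "Obj J"]) (auto simp: pushed_trans_def)
  then show ?thesis
    using pushed_over X_over unfolding FA_Diag_right_map[OF pushed_arr]
    by (simp add: pushed_arr_def m_def)
qed

text \<open>Projection to \<open>m\<close> fixes the target category and the shape of
  \<open>n\<close>. Uniqueness of lifts then forces the functor \<open>Y\<close> and every component
  of the transformation.\<close>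

lemma pushed_arr_unique:
  assumes n: "n \<in> diag_right_arrs E" and src: "Src n = (J, X)"
    and over: "FA (Diag_right_map E \<pi>) n = m"
  shows "n = pushed_arr"
proof -
  obtain Y where tgt: "Tgt n = (J', Y)" and Y_over: "comp_funct J' \<pi> Y = D'"
    and shape: "Shape n = R" and trans_over: "(\<lambda>j\<in>Obj J. FA \<pi> (Trans n j)) = \<rho>"
    using over src unfolding FA_Diag_right_map[OF n] by (cases "Tgt n") (auto simp: m_def)
  note nD = diag_right_arrsD[OF n, unfolded src tgt shape, simplified]
  note Y = nD(2)
  have trans_j: "FA \<pi> (Trans n j) = \<rho> j" if "j \<in> Obj J" for j
    using that trans_over by (auto dest: fun_cong[of _ _ j])
  have Y_obj: "FO Y j' = pushed_obj j'" if j': "j' \<in> Obj J'" for j'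
  proof -
    obtain j f' where j: "j \<in> Obj J" and f': "f' \<in> hom J' (FO R j) j'"
      using slice_nonempty[OF j'] .
    note nj = nD(6)[OF j] and Yf' = functor_hom[OF Y f']
    have "FA \<pi> (FA Y f') = FA D' f'"
      using homD(1)[OF f'] by (simp flip: Y_over)
    \<comment> \<open>This composite runs from \<open>X j\<close> to \<open>Y j'\<close>, so its
      codomain \<open>Y j'\<close> must be the transport that computes
      \<open>pushed_obj j'\<close>.\<close>
    then have "FA \<pi> (Comp E (FA Y f') (Trans n j)) = Comp C (FA D' f') (\<rho> j)"
      using functor_comp[OF proj nj Yf'] trans_j[OF j] by simp
    then show ?thesis
      using lift_eq(2)[OF E.Comp_hom[OF nj Yf']] pushed_obj_eq[OF j f']
      by (simp add: slice_push_def)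
  qed
  have "Y = pushed"
    using Y is_functor_pushed
  proof (rule functor_eqI)
    show "FO Y x = FO pushed x" if "x \<in> Obj J'" for x
      using that by (simp add: Y_obj FO_pushed)
    show "FA Y g = FA pushed g" if g: "g \<in> Arr J'" for g
    proof -
      \<comment> \<open>With the objects matched, \<open>Y g\<close> and \<open>pushed\<close> at
        \<open>g\<close> start at one object and lie over the same arrow.\<close>
      note gh = J'.arr_dom_cod(3)[OF g]
      have "FA \<pi> (FA Y g) = FA D' g"
        using g by (simp flip: Y_over)
      then show ?thesis
        using lift_eq(1)[OF functor_hom[OF Y gh]] FA_pushed[OF gh] Y_obj[OF J'.arr_dom_cod(1)[OF g]]
        by simp
    qed
  qed
  moreover have "Trans n = pushed_trans"
    using nD(5) lift_eq(1)[OF nD(6) trans_j]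
    by (intro extensionalityI[of _ "Obj J"]) (auto simp: pushed_trans_def)
  ultimately show ?thesis
    using src tgt shape by (simp add: pushed_arr_def)
qed

end

lemma relatively_initial_imp_pushforward_property:
  fixes m :: "('jo, 'jm, 'o, 'm) diag_arr"
  assumes initial: "relatively_initial C m"
  shows "pushforward_property TYPE('e) TYPE('f) C m"
  unfolding pushforward_property_def
proof (intro conjI allI impI)
  show m: "m \<in> Arr (Diag_right C)"
    using initial by (simp add: relatively_initial_def)
  fix E :: "('e, 'f) cat" and \<pi>
  assume opfib: "discrete_opfibration E C \<pi>"
  then have proj: "is_functor E C \<pi>"
    by (simp add: discrete_opfibration_def)
  show "discrete_opfibration_at (Diag_right E) (Diag_right C) (Diag_right_map E \<pi>) m"
    unfolding discrete_opfibration_at_def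
  proof (intro conjI ballI impI is_functor_Diag_right_map[OF proj] m)
    fix Z assume "Z \<in> Obj (Diag_right E)"
      and over: "FO (Diag_right_map E \<pi>) Z = Dom (Diag_right C) m"
    then have Z: "Z \<in> diagrams E" by simp
    obtain J D J' D' R \<rho> where mD: "m = \<lparr>Src = (J, D), Tgt = (J', D'), Shape = R, Trans = \<rho>\<rparr>"
      using m by (auto simp: diag_right_arrs_def)
    have "Src m = FO (Diag_right_map E \<pi>) Z"
      using over m by simp
    then obtain X where ZX: "Z = (J, X)" and X_over: "comp_funct J \<pi> X = D"
      unfolding FO_Diag_right_map[OF Z] by (cases Z) (auto simp: mD)
    \<comment> \<open>Each object \<open>Z\<close> over the source of \<open>m\<close> yields its
      own instance: \<open>Z\<close> has shape \<open>J\<close>, and its functor \<open>X\<close>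
      lies over \<open>D\<close>.\<close>
    interpret pushforward E C \<pi> J J' D D' R \<rho> X m
      using opfib initial Z X_over
      by unfold_locales (auto simp: mD ZX diagrams_iff)
    show "\<exists>!g. g \<in> Arr (Diag_right E) \<and> Dom (Diag_right E) g = Z \<and>
        FA (Diag_right_map E \<pi>) g = m"
    proof (rule ex1I[of _ pushed_arr])
      show "pushed_arr \<in> Arr (Diag_right E) \<and> Dom (Diag_right E) pushed_arr = Z \<and>
          FA (Diag_right_map E \<pi>) pushed_arr = m"
        using pushed_arr pushed_arr_over by (simp add: ZX) (simp add: pushed_arr_def)
    qed (use pushed_arr_unique in \<open>auto simp: ZX\<close>)
  qed
qed

text \<open>The second half is the first applied to \<open>reverse_arr C m\<close>, since
  \<open>weak_equivalence\<close> means strong with this reverse having the pushforward property.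
  The types \<open>'e\<close> and \<open>'f\<close> are arbitrary, so all total categories are
  covered.\<close>

theorem theorem9p12:
  fixes C :: "('o, 'm) cat"
  assumes "category C"
  shows "(\<forall>m :: ('jo, 'jm, 'o, 'm) diag_arr.
            m \<in> Arr (Diag_right C) \<and> relatively_initial C m \<longrightarrow>
              pushforward_property TYPE('e) TYPE('f) C m) \<and>
         (\<forall>m :: ('jo, 'jm, 'o, 'm) diag_arr.
            m \<in> Arr (Diag_left C) \<and> strong_left C m \<and>
            relatively_initial C (reverse_arr C m) \<longrightarrow>
              weak_equivalence TYPE('e) TYPE('f) C m)"
  using relatively_initial_imp_pushforward_property by (auto simp: weak_equivalence_def)

end
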